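(* Let $M\subset\mathbb{R}^3$ and $\bar M\subset\mathbb{R}^3$ be domains with coordinates $\mathbf{x}=(x,y,z)$ and $\mathbf{X}=(X,Y,Z)$, equipped with probability densities $\rho(\mathbf{x})$ and $\bar\rho(\mathbf{X})$ respectively, and let the cost $c:M\times\bar M\to\mathbb{R}$ be $$c(\mathbf{x},\mathbf{X})=\frac{(x-X)^2}{2}+\frac{(y-Y)^2}{2}-zZ.$$ Equip $T^*M\simeq M\times\bar M$ with the symplectic form $\omega_c$ determined by $c$. Then: (i) $(\mathbf{x},\mathbf{X})$ are canonical coordinates, i.e. $\omega_c=dx\wedge dX+dy\wedge dY+dz\wedge dZ$; (ii) as symmetric $(0,2)$-tensor fields on $M\times\bar M$, $$g_\alpha=[\rho(\mathbf{x})\bar\rho(\mathbf{X})]^{2/3}\,h_c^{\rho,\bar\rho},$$ where $h_c^{\rho,\bar\rho}$ is the Kim-McCann-Warren metric and $g_\alpha$ is the Lychagin-Rubtsov metric associated with the Monge-Ampère structure $(\omega_c,\alpha)$, $\alpha$ being the effective $3$-form corresponding to the Monge-Ampère equation $$\bar\rho(\mathbf{X})\det\big(D^2u+D_{\mathbf{x}}^2c\big)=\rho(\mathbf{x}),\qquad \mathbf{X}=Du(\mathbf{x})+(x,y,0),\qquad D_{\mathbf{x}}^2c=\mathrm{diag}(1,1,0).$$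
   Context: Notation. $D_{\mathbf{x}}D_{\mathbf{X}}c$ denotes the $3\times3$ matrix of mixed derivatives $\partial^2c/\partial\mathbf{x}^i\partial\mathbf{X}^j$, and $D_{\mathbf{x}}^2c$ the Hessian of $c$ in $\mathbf{x}$. Block matrices below are with respect to the coordinates $(\mathbf{x},\mathbf{X})$, and a matrix $B$ denotes the bilinear form $(V,W)\mapsto V^TBW$. A domain is a (nonempty) open set. Symplectic form on $M\times\bar M$: $$\omega_c=\begin{pmatrix}0&-D_{\mathbf{x}}D_{\mathbf{X}}c\\(D_{\mathbf{x}}D_{\mathbf{X}}c)^T&0\end{pmatrix}.$$ Kim-McCann-Warren metric on $M\times\bar M$ (dimension $n=3$): $$h_c^{\rho,\bar\rho}=\left(\frac{\rho(\mathbf{x})\bar\rho(\mathbf{X})}{|\det(D_{\mathbf{x}}D_{\mathbf{X}}c)|}\right)^{1/3}\begin{pmatrix}0&-D_{\mathbf{x}}D_{\mathbf{X}}c\\-(D_{\mathbf{x}}D_{\mathbf{X}}c)^T&0\end{pmatrix}.$$ Identification. $M\times\bar M$ is identified with (an open subset of) $T^*M$ by $(\mathbf{x},\mathbf{X})\mapsto(\mathbf{x},p)$ with $p=-D_{\mathbf{x}}c(\mathbf{x},\mathbf{X})=\mathbf{X}-(x,y,0)$. Thus for a smooth function $u$ the section $du$ is the map $\mathbf{x}\mapsto(\mathbf{x},\mathbf{X}=Du(\mathbf{x})+(x,y,0))$. This manifold is given the symplectic form $\omega=\omega_c$. Effective form. A $3$-form $\alpha$ is effective if $\omega\wedge\alpha=0$.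 It defines the Monge-Ampère operator $\Delta_\alpha(u)=(du)^*\alpha$, with associated Monge-Ampère equation $\Delta_\alpha(u)=0$. The effective $3$-form $\alpha$ corresponding to the equation in the claim is the one on $M\times\bar M$ with $$(du)^*\alpha=\big[\bar\rho(Du+(x,y,0))\det(D^2u+\mathrm{diag}(1,1,0))-\rho(\mathbf{x})\big]\,dx\wedge dy\wedge dz$$ for every open $U\subset M$ and every smooth $u:U\to\mathbb{R}$ such that $Du(\mathbf{x})+(x,y,0)\in\bar M$ for all $\mathbf{x}\in U$. (The coefficients of $\alpha$ are as regular as $\rho,\bar\rho$.) Lychagin-Rubtsov metric. $g_\alpha$ is the symmetric bilinear form defined by $$g_\alpha(X_1,X_2)\,\frac{\omega\wedge\omega\wedge\omega}{3!}=\iota_{X_1}\alpha\wedge\iota_{X_2}\alpha\wedge\omega$$ for all vector fields $X_1,X_2$, where $\iota$ is the interior product. *)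

theory Defs
  imports "HOL-Probability.Probability" "HOL-Combinatorics.Permutations"
begin

section \<open>Partial derivatives and smooth functions\<close>

definition pderivative :: "'n \<Rightarrow> (real ^ 'n \<Rightarrow> real) \<Rightarrow> real ^ 'n \<Rightarrow> real" where
  "pderivative i f x = frechet_derivative f (at x) (axis i 1)"

definition grad :: "(real ^ 'n \<Rightarrow> real) \<Rightarrow> real ^ 'n \<Rightarrow> real ^ 'n" where
  "grad f x = (\<chi> i. pderivative i f x)"

definition hessian :: "(real ^ 'n \<Rightarrow> real) \<Rightarrow> real ^ 'n \<Rightarrow> real ^ 'n ^ 'n" where
  "hessian f x = (\<chi> i j. pderivative i (pderivative j f) x)"

fun Ck_on :: "nat \<Rightarrow> (real ^ 'n) set \<Rightarrow> (real ^ 'n \<Rightarrow> real) \<Rightarrow> bool" where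
  "Ck_on 0 U f = continuous_on U f"
| "Ck_on (Suc k) U f = (f differentiable_on U \<and> (\<forall>i. Ck_on k U (pderivative i f)))"

text \<open>Used for open \<open>U\<close> only.\<close>

definition smooth_on :: "(real ^ 'n) set \<Rightarrow> (real ^ 'n \<Rightarrow> real) \<Rightarrow> bool" where
  "smooth_on U f \<longleftrightarrow> (\<forall>k. Ck_on k U f)"


section \<open>Differential forms\<close>

text \<open>
  A \<open>k\<close>-covector takes its \<open>k\<close> arguments as \<open>v 0, \<dots>, v (k - 1)\<close> and ignores the rest of
  the sequence \<open>v\<close>. A form on a set \<open>D\<close> is an extensional field of covectors on \<open>D\<close>; no
  regularity of its coefficients is imposed.
\<close>

type_synonym 'v covector = "(nat \<Rightarrow> 'v) \<Rightarrow> real"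

definition alternating :: "nat \<Rightarrow> 'v::real_vector covector \<Rightarrow> bool" where
  "alternating k a \<longleftrightarrow>
     (\<forall>v w. (\<forall>i<k. v i = w i) \<longrightarrow> a v = a w) \<and>
     (\<forall>v. \<forall>i<k. linear (\<lambda>y. a (v(i := y)))) \<and>
     (\<forall>v. \<forall>i<k. \<forall>j<k. i \<noteq> j \<and> v i = v j \<longrightarrow> a v = 0)"

definition forms_on :: "nat \<Rightarrow> 'v::real_vector set \<Rightarrow> ('v \<Rightarrow> 'v covector) set" where
  "forms_on k D = D \<rightarrow>\<^sub>E {a. alternating k a}"

text \<open>
  The normalisation is the one with \<open>(a \<and> b) (v, w) = a v * b w - a w * b v\<close> for
  1-covectors.
\<close>

definition wedge :: "nat \<Rightarrow> nat \<Rightarrow> 'v covector \<Rightarrow> 'v covector \<Rightarrow> 'v covector" where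
  "wedge k l a b v =
     (\<Sum>\<sigma> | \<sigma> permutes {..<k + l}.
        of_int (sign \<sigma>) * a (\<lambda>i. v (\<sigma> i)) * b (\<lambda>i. v (\<sigma> (k + i)))) / (fact k * fact l)"

definition interior_product :: "'v \<Rightarrow> 'v covector \<Rightarrow> 'v covector" where
  "interior_product V a v = a (case_nat V v)"

definition differential :: "('v::real_normed_vector \<Rightarrow> real) \<Rightarrow> 'v \<Rightarrow> 'v covector" where
  "differential f p v = frechet_derivative f (at p) (v 0)"

definition pullback ::
  "('u::real_normed_vector \<Rightarrow> 'v::real_normed_vector) \<Rightarrow> ('v \<Rightarrow> 'v covector) \<Rightarrow> 'u \<Rightarrow> 'u covector"
where
  "pullback \<phi> \<alpha> x v = \<alpha> (\<phi> x) (\<lambda>i. frechet_derivative \<phi> (at x) (v i))"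


section \<open>The geometry determined by a cost\<close>

type_synonym R3 = "real ^ 3"

definition mixed_derivs :: "(R3 \<Rightarrow> R3 \<Rightarrow> real) \<Rightarrow> R3 \<Rightarrow> R3 \<Rightarrow> real ^ 3 ^ 3" where
  "mixed_derivs c x X = (\<chi> i j. pderivative i (\<lambda>x'. pderivative j (c x') X) x)"

definition block_form ::
  "real ^ 3 ^ 3 \<Rightarrow> real ^ 3 ^ 3 \<Rightarrow> real ^ 3 ^ 3 \<Rightarrow> real ^ 3 ^ 3 \<Rightarrow> R3 \<times> R3 \<Rightarrow> R3 \<times> R3 \<Rightarrow> real"
where
  "block_form A B C D V W =
     fst V \<bullet> (A *v fst W) + fst V \<bullet> (B *v snd W) + snd V \<bullet> (C *v fst W) + snd V \<bullet> (D *v snd W)"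

definition omega :: "(R3 \<Rightarrow> R3 \<Rightarrow> real) \<Rightarrow> R3 \<times> R3 \<Rightarrow> (R3 \<times> R3) covector" where
  "omega c p v =
     (let D = mixed_derivs c (fst p) (snd p)
      in block_form 0 (- D) (transpose D) 0 (v 0) (v 1))"

definition kim_mccann_warren ::
  "(R3 \<Rightarrow> R3 \<Rightarrow> real) \<Rightarrow> (R3 \<Rightarrow> real) \<Rightarrow> (R3 \<Rightarrow> real) \<Rightarrow> R3 \<times> R3 \<Rightarrow> R3 \<times> R3 \<Rightarrow> R3 \<times> R3 \<Rightarrow> real"
where
  "kim_mccann_warren c \<rho> \<rho>' p V W =
     (let D = mixed_derivs c (fst p) (snd p)
      in (\<rho> (fst p) * \<rho>' (snd p) / \<bar>det D\<bar>) powr (1 / 3)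
           * block_form 0 (- D) (- transpose D) 0 V W)"


section \<open>Monge-Ampere structures\<close>

definition effective_on ::
  "'v set \<Rightarrow> ('v \<Rightarrow> 'v covector) \<Rightarrow> ('v \<Rightarrow> 'v covector) \<Rightarrow> bool"
where
  "effective_on D \<omega> \<alpha> \<longleftrightarrow> (\<forall>p\<in>D. \<forall>v. wedge 2 3 (\<omega> p) (\<alpha> p) v = 0)"

text \<open>
  Used on a 6-dimensional space: both sides of the equation are 6-covectors, and \<open>r\<close> is unique
  because the symplectic volume \<open>(\<omega> \<and> \<omega> \<and> \<omega>) / 3!\<close> does not vanish.
\<close>

definition lychagin_rubtsov ::
  "('v \<Rightarrow> 'v covector) \<Rightarrow> ('v \<Rightarrow> 'v covector) \<Rightarrow> 'v \<Rightarrow> 'v \<Rightarrow> 'v \<Rightarrow> real"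
where
  "lychagin_rubtsov \<omega> \<alpha> p V W =
     (THE r. \<forall>v. r * (wedge 4 2 (wedge 2 2 (\<omega> p) (\<omega> p)) (\<omega> p) v / fact 3) =
        wedge 4 2 (wedge 2 2 (interior_product V (\<alpha> p)) (interior_product W (\<alpha> p))) (\<omega> p) v)"


section \<open>The cost and its Monge-Ampere equation\<close>

definition cost :: "R3 \<Rightarrow> R3 \<Rightarrow> real" where
  "cost x X = (x $ 1 - X $ 1)\<^sup>2 / 2 + (x $ 2 - X $ 2)\<^sup>2 / 2 - x $ 3 * X $ 3"

definition du_section :: "(R3 \<Rightarrow> real) \<Rightarrow> R3 \<Rightarrow> R3 \<times> R3" where
  "du_section u x = (x, grad u x + vector [x $ 1, x $ 2, 0])"

definition prob_density_on :: "R3 set \<Rightarrow> (R3 \<Rightarrow> real) \<Rightarrow> bool" where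
  "prob_density_on M \<rho> \<longleftrightarrow>
     (\<forall>x\<in>M. 0 \<le> \<rho> x) \<and> \<rho> \<in> borel_measurable (lebesgue_on M) \<and>
     prob_space (density (lebesgue_on M) (\<lambda>x. ennreal (\<rho> x)))"

definition monge_ampere_form ::
  "R3 set \<Rightarrow> R3 set \<Rightarrow> (R3 \<Rightarrow> real) \<Rightarrow> (R3 \<Rightarrow> real) \<Rightarrow>
   (R3 \<times> R3 \<Rightarrow> (R3 \<times> R3) covector) \<Rightarrow> bool"
where
  "monge_ampere_form M M' \<rho> \<rho>' \<alpha> \<longleftrightarrow>
     \<alpha> \<in> forms_on 3 (M \<times> M') \<and>
     effective_on (M \<times> M') (omega cost) \<alpha> \<and>
     (\<forall>U u. open U \<and> U \<subseteq> M \<and> smooth_on U u \<and> (\<forall>x\<in>U. snd (du_section u x) \<in> M') \<longrightarrow>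
        (\<forall>x\<in>U. let X = snd (du_section u x) in
           pullback (du_section u) \<alpha> x =
           (\<lambda>v. (\<rho>' X * det (hessian u x + hessian (\<lambda>x'. cost x' X) x) - \<rho> x) *
             wedge 1 2 (differential (\<lambda>y. y $ 1) x)
               (wedge 1 1 (differential (\<lambda>y. y $ 2) x) (differential (\<lambda>y. y $ 3) x)) v)))"

text \<open>
  Under \<open>p = - D\<^sub>x c(x, X)\<close> the covector \<open>Du(x)\<close> corresponds to the second component of
  \<open>du_section u x\<close>, and the Hessian of the cost in \<open>x\<close> is \<open>diag(1, 1, 0)\<close>.
\<close>

lemma pderivative_eqI:
  "(f has_derivative f') (at x) \<Longrightarrow> pderivative i f x = f' (axis i 1)"
  unfolding pderivative_def by (metis frechet_derivative_at)

lemma has_derivative_cost: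
  "((\<lambda>x. cost x X) has_derivative
    (\<lambda>h. (x $ 1 - X $ 1) * h $ 1 + (x $ 2 - X $ 2) * h $ 2 - X $ 3 * h $ 3)) (at x)"
  unfolding cost_def
  by (rule derivative_eq_intros bounded_linear.has_derivative[OF bounded_linear_vec_nth] refl
      | simp add: fun_eq_iff field_simps)+

lemma pderivative_cost:
  "pderivative i (\<lambda>x. cost x X) = (\<lambda>x. (x - X) $ i * (if i = 3 then 0 else 1) - (if i = 3 then X $ 3 else 0))"
  using exhaust_3[of i]
  by (auto simp: pderivative_eqI[OF has_derivative_cost] axis_def fun_eq_iff)

lemma momentum_cost: "- grad (\<lambda>x. cost x X) x = X - vector [x $ 1, x $ 2, 0]"
  by (simp add: grad_def pderivative_cost vec_eq_iff forall_3 vector_3)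

lemma hessian_cost:
  "hessian (\<lambda>x. cost x X) x = (\<chi> i j. if i = j \<and> i \<noteq> 3 then 1 else 0)"
proof -
  have "pderivative i (pderivative j (\<lambda>x. cost x X)) x = (if i = j \<and> i \<noteq> 3 then 1 else 0)" for i j
  proof -
    have "(pderivative j (\<lambda>x. cost x X) has_derivative
        (\<lambda>h. h $ j * (if j = 3 then 0 else 1))) (at x)"
      unfolding pderivative_cost
        by (auto intro!: derivative_eq_intros bounded_linear.has_derivative[OF bounded_linear_vec_nth])
    from pderivative_eqI[OF this] show ?thesis by (auto simp: axis_def)
  qed
  then show ?thesis by (simp add: hessian_def)
qed

lemma momentum_du_section:
  "- grad (\<lambda>x. cost x (snd (du_section u x0))) x0 = grad u x0"
  by (simp add: momentum_cost du_section_def)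

end

theory Submission
  imports Defs
begin

text \<open>
  Exterior products of covectors are written as determinants. Then \<open>\<omega>\<close> and
  \<open>\<alpha> = \<rho>'(X) dX \<and> dY \<and> dZ - \<rho>(x) dx \<and> dy \<and> dz\<close> are sums of such products of coordinate covectors, and the
  identities between 6-covectors follow by discarding products with a repeated factor and sorting the others.

  The form \<open>\<alpha>\<close> is unique because quadratic functions \<open>u\<close> realise every symmetric matrix as the
  slope of the graph of \<open>du\<close> through a given point, and an effective 3-covector that vanishes on all
  these Lagrangian graphs is zero.
\<close>

section \<open>Exterior products of covectors\<close>

text \<open>Unfolding \<open>wedge\<close> in \<omega> \<and> \<omega> \<and> \<omega> would nest
  sums over the permutations of four and of six arguments. Since \<open>wedge_wedge_list\<close>
  turns the wedge of two products into a concatenation of lists, only the repetition and the order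
  of factors remain to be inspected.

  The form \<alpha> is known only through effectiveness and its pullbacks, so it must be identified
  before its metric can be computed. The pullbacks alone determine it up to \<omega> \<and> \<beta>
  with a 1-form \<beta>, because \<omega> vanishes on the graph of every du; effectiveness removes
  this freedom. Forms are arbitrary fields of covectors here, so the identification is linear
  algebra at one point at a time.

  As for the exponents: the matrix of mixed derivatives is minus the identity, with determinant of
  absolute value 1. Both metrics are then multiples of one pairing, with factors r and
  \<open>r powr (1 / 3)\<close> where r is the product of the densities, whence the factor
  \<open>r powr (2 / 3)\<close>.\<close>

definition wedge_list :: "('v \<Rightarrow> real) list \<Rightarrow> 'v covector" where
  "wedge_list fs v =
     (\<Sum>\<sigma> | \<sigma> permutes {..<length fs}. of_int (sign \<sigma>) * (\<Prod>i<length fs. (fs ! i) (v (\<sigma> i))))"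

lemma sign_compose_permutes:
  assumes "finite A" "\<sigma> permutes A" "\<tau> permutes A"
  shows "sign (\<sigma> \<circ> \<tau>) = sign \<sigma> * sign \<tau>"
  using assms by (intro sign_compose) (auto simp: permutation_permutes)

lemma wedge_list_permute:
  assumes \<pi>: "\<pi> permutes {..<length fs}"
  shows "wedge_list (permute_list \<pi> fs) v = of_int (sign \<pi>) * wedge_list fs v"
proof -
  let ?P = "\<lambda>\<sigma>. \<Prod>i<length fs. (fs ! i) (v (\<sigma> i))"
  have P: "(\<Prod>i<length fs. (permute_list \<pi> fs ! i) (v ((\<sigma> \<circ> \<pi>) i))) = ?P \<sigma>" for \<sigma>
    using prod.permute[OF \<pi>, of "\<lambda>i. (fs ! i) (v (\<sigma> i))"]
    by (simp add: permute_list_nth[OF \<pi>] o_def)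
  have "wedge_list (permute_list \<pi> fs) v =
      (\<Sum>\<sigma> | \<sigma> permutes {..<length fs}. of_int (sign (\<sigma> \<circ> \<pi>)) * ?P \<sigma>)"
    unfolding wedge_list_def length_permute_list
    by (subst sum_permutations_compose_right[OF \<pi>]) (simp only: P)
  also have "\<dots> = of_int (sign \<pi>) * wedge_list fs v"
    unfolding wedge_list_def sum_distrib_left
    by (intro sum.cong refl) (simp add: sign_compose_permutes[OF _ _ \<pi>])
  finally show ?thesis .
qed

lemma wedge_list_swap:
  assumes "i < length fs" "j < length fs" "i \<noteq> j"
  shows "wedge_list (fs[i := fs ! j, j := fs ! i]) v = - wedge_list fs v"
proof -
  have t: "Transposition.transpose i j permutes {..<length fs}"
    using assms by (auto intro: permutes_swap_id)
  have "permute_list (Transposition.transpose i j) fs = fs[i := fs ! j, j := fs ! i]"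
    by (rule nth_equalityI)
       (use assms in \<open>auto simp: permute_list_nth[OF t] nth_list_update Transposition.transpose_def\<close>)
  with wedge_list_permute[OF t, of v] assms show ?thesis
    by (simp add: sign_swap_id)
qed

text \<open>Swapping two equal factors changes the sign but not the list. As a conditional rewrite
  rule it discards every product in which the same coordinate occurs twice.\<close>

lemma wedge_list_not_distinct:
  assumes "\<not> distinct fs"
  shows "wedge_list fs v = 0"
proof -
  from assms obtain i j where ij: "i < length fs" "j < length fs" "i \<noteq> j" "fs ! i = fs ! j"
    by (auto simp: distinct_conv_nth)
  then have "fs[i := fs ! j, j := fs ! i] = fs"
    by (metis list_update_id)
  with wedge_list_swap[OF ij(1-3), of v] show ?thesis by simp
qed

lemma prod_lessThan_add:
  fixes f :: "nat \<Rightarrow> real"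
  shows "(\<Prod>i<k + l. f i) = (\<Prod>i<k. f i) * (\<Prod>i<l. f (k + i))"
  by (induction l) (simp_all add: mult.assoc)

text \<open>Each pair of permutations from the two inner determinants acts on the two blocks of
  factors and so is one permutation of all k + l positions. Reindexing the outer sum by it yields
  the full determinant; the k! l! pairs give equal contributions, which cancel the denominator of
  \<open>wedge\<close>.\<close>

lemma wedge_wedge_list:
  fixes fs gs :: "('v \<Rightarrow> real) list"
  shows "wedge (length fs) (length gs) (wedge_list fs) (wedge_list gs) = wedge_list (fs @ gs)"
proof
  fix v :: "nat \<Rightarrow> 'v"
  define k l where "k = length fs" and "l = length gs"
  let ?P = "\<lambda>\<sigma>. \<Prod>i<k + l. ((fs @ gs) ! i) (v (\<sigma> i))"
  have inner: "(\<Sum>\<sigma> | \<sigma> permutes {..<k + l}. of_int (sign \<sigma>) *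
        (of_int (sign \<tau>) * (\<Prod>i<k. (fs ! i) (v (\<sigma> (\<tau> i))))) *
        (of_int (sign \<tau>') * (\<Prod>i<l. (gs ! i) (v (\<sigma> (k + \<tau>' i)))))) = wedge_list (fs @ gs) v"
    if \<tau>: "\<tau> permutes {..<k}" and \<tau>': "\<tau>' permutes {..<l}" for \<tau> \<tau>'
  proof -
    \<comment> \<open>\<mu> is \<tau>' moved to the second block of positions; \<tau> and \<mu> have
      disjoint supports, so \<pi> acts blockwise and its sign is the product of theirs.\<close>
    define \<mu> where "\<mu> = map_permutation {..<l} ((+) k) \<tau>'"
    define \<pi> where "\<pi> = \<tau> \<circ> \<mu>"
    have "bij_betw ((+) k) {..<l} {k..<k + l}"
      by (metis bij_betw_add add.commute add_0 atLeast0LessThan image_add_atLeastLessThan)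
    then have \<mu>: "\<mu> permutes {k..<k + l}"
      unfolding \<mu>_def using \<tau>' by (rule map_permutation_permutes)
    have \<tau>_kl: "\<tau> permutes {..<k + l}" and \<mu>_kl: "\<mu> permutes {..<k + l}"
      by (auto intro: permutes_subset[OF \<tau>] permutes_subset[OF \<mu>])
    have \<pi>: "\<pi> permutes {..<k + l}"
      unfolding \<pi>_def by (rule permutes_compose[OF \<mu>_kl \<tau>_kl])
    have "sign \<mu> = sign \<tau>'"
      unfolding \<mu>_def by (rule sign_map_permutation) (use \<tau>' in auto)
    then have sign_\<pi>: "sign \<pi> = sign \<tau> * sign \<tau>'"
      unfolding \<pi>_def by (simp add: sign_compose_permutes[OF _ \<tau>_kl \<mu>_kl])
    have \<pi>_low: "\<pi> i = \<tau> i" if "i < k" for i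
      using that permutes_not_in[OF \<mu>, of i] by (simp add: \<pi>_def)
    have \<pi>_high: "\<pi> (k + i) = k + \<tau>' i" if "i < l" for i
    proof -
      have "\<mu> (k + i) = k + \<tau>' i"
        unfolding \<mu>_def using that by (intro map_permutation_apply) auto
      then show ?thesis
        by (simp add: \<pi>_def permutes_not_in[OF \<tau>])
    qed
    have P: "?P (\<sigma> \<circ> \<pi>) =
        (\<Prod>i<k. (fs ! i) (v (\<sigma> (\<tau> i)))) * (\<Prod>i<l. (gs ! i) (v (\<sigma> (k + \<tau>' i))))" for \<sigma>
      unfolding prod_lessThan_add
      by (intro arg_cong2[where f = "(*)"] prod.cong refl)
         (simp_all add: \<pi>_low \<pi>_high nth_append flip: k_def)
    have "wedge_list (fs @ gs) v =
        (\<Sum>\<sigma> | \<sigma> permutes {..<k + l}. of_int (sign (\<sigma> \<circ> \<pi>)) * ?P (\<sigma> \<circ> \<pi>))"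
      unfolding wedge_list_def length_append k_def[symmetric] l_def[symmetric]
      by (rule sum_permutations_compose_right[OF \<pi>])
    also have "\<dots> = (\<Sum>\<sigma> | \<sigma> permutes {..<k + l}. of_int (sign \<sigma>) *
        (of_int (sign \<tau>) * (\<Prod>i<k. (fs ! i) (v (\<sigma> (\<tau> i))))) *
        (of_int (sign \<tau>') * (\<Prod>i<l. (gs ! i) (v (\<sigma> (k + \<tau>' i))))))"
      by (intro sum.cong refl)
         (simp only: P sign_compose_permutes[OF _ _ \<pi>] sign_\<pi> mem_Collect_eq of_int_mult ac_simps finite_lessThan)
    finally show ?thesis by simp
  qed
  have "wedge k l (wedge_list fs) (wedge_list gs) v * (fact k * fact l) =
      (\<Sum>\<sigma> | \<sigma> permutes {..<k + l}. of_int (sign \<sigma>) *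
        (\<Sum>\<tau> | \<tau> permutes {..<k}. of_int (sign \<tau>) * (\<Prod>i<k. (fs ! i) (v (\<sigma> (\<tau> i))))) *
        (\<Sum>\<tau>' | \<tau>' permutes {..<l}. of_int (sign \<tau>') * (\<Prod>i<l. (gs ! i) (v (\<sigma> (k + \<tau>' i))))))"
    by (simp add: wedge_def wedge_list_def flip: k_def l_def)
  also have "\<dots> = (\<Sum>\<sigma> | \<sigma> permutes {..<k + l}. \<Sum>\<tau>' | \<tau>' permutes {..<l}. \<Sum>\<tau> | \<tau> permutes {..<k}.
        of_int (sign \<sigma>) *
        (of_int (sign \<tau>) * (\<Prod>i<k. (fs ! i) (v (\<sigma> (\<tau> i))))) *
        (of_int (sign \<tau>') * (\<Prod>i<l. (gs ! i) (v (\<sigma> (k + \<tau>' i))))))"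
    by (simp only: sum_distrib_left sum_distrib_right)
  also have "\<dots> = (\<Sum>\<tau>' | \<tau>' permutes {..<l}. \<Sum>\<tau> | \<tau> permutes {..<k}. wedge_list (fs @ gs) v)"
    by (rule trans[OF sum.swap], rule sum.cong[OF refl], rule trans[OF sum.swap],
        rule sum.cong[OF refl], rule inner) simp_all
  also have "\<dots> = wedge_list (fs @ gs) v * (fact k * fact l)"
    by (simp add: card_permutations[OF refl])
  finally show "wedge (length fs) (length gs) (wedge_list fs) (wedge_list gs) v = wedge_list (fs @ gs) v"
    by (simp flip: k_def l_def)
qed

lemma wedge_add_left:
  "wedge k l (\<lambda>v. a v + a' v) b = (\<lambda>v. wedge k l a b v + wedge k l a' b v)"
  and wedge_add_right:
  "wedge k l a (\<lambda>v. b v + b' v) = (\<lambda>v. wedge k l a b v + wedge k l a b' v)"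
  and wedge_diff_left:
  "wedge k l (\<lambda>v. a v - a' v) b = (\<lambda>v. wedge k l a b v - wedge k l a' b v)"
  and wedge_diff_right:
  "wedge k l a (\<lambda>v. b v - b' v) = (\<lambda>v. wedge k l a b v - wedge k l a b' v)"
  and wedge_scale_left:
  "wedge k l (\<lambda>v. c * a v) b = (\<lambda>v. c * wedge k l a b v)"
  and wedge_scale_right:
  "wedge k l a (\<lambda>v. c * b v) = (\<lambda>v. c * wedge k l a b v)"
  unfolding wedge_def fun_eq_iff
  by (simp_all add: algebra_simps sum.distrib sum_subtractf add_divide_distrib diff_divide_distrib
      sum_distrib_left)

lemma wedge_list_1: "wedge_list [f] v = f (v 0)"
  by (simp add: wedge_list_def permutes_sing lessThan_Suc)


lemma wedge_list_2: "wedge_list [f, g] v = f (v 0) * g (v 1) - f (v 1) * g (v 0)"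
proof -
  have s: "{..<Suc (Suc 0)} = insert 0 {1}" by auto
  show ?thesis
    unfolding wedge_list_def
    by (simp add: s sum_over_permutations_insert permutes_sing sign_swap_id)
qed

lemma wedge_list_3:
  "wedge_list [f, g, h] v =
     f (v 0) * (g (v 1) * h (v 2) - g (v 2) * h (v 1))
   - f (v 1) * (g (v 0) * h (v 2) - g (v 2) * h (v 0))
   + f (v 2) * (g (v 0) * h (v 1) - g (v 1) * h (v 0))"
proof -
  have s: "{..<Suc (Suc (Suc 0))} = insert 0 (insert 1 {2})" by auto
  show ?thesis
    unfolding wedge_list_def
    by (simp add: s sum_over_permutations_insert permutes_sing sign_swap_id sign_compose
        permutation_swap_id Transposition.transpose_def algebra_simps numeral_2_eq_2)
qed

section \<open>The symplectic form and the two metrics\<close>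

definition x_coord :: "3 \<Rightarrow> R3 \<times> R3 \<Rightarrow> real" where
  "x_coord i q = fst q $ i"

definition X_coord :: "3 \<Rightarrow> R3 \<times> R3 \<Rightarrow> real" where
  "X_coord i q = snd q $ i"

text \<open>Up to terms in x alone or in X alone, the cost is minus the inner product of x and
  X.\<close>

lemma mixed_derivs_cost: "mixed_derivs cost x X = mat (- 1)"
proof -
  have "pderivative j (cost x') X = (X - x') $ j * (if j = 3 then 0 else 1) - (if j = 3 then x' $ 3 else 0)"
    for j x'
  proof -
    \<comment> \<open>The cost is symmetric in its two arguments, so the derivative in X is an
      instance of the one in x.\<close>
    have "cost x' = (\<lambda>X. cost X x')"
      by (simp add: cost_def fun_eq_iff power2_commute mult.commute)
    then show ?thesis by (simp add: pderivative_cost)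
  qed
  moreover have "pderivative i
      (\<lambda>x'. (X - x') $ j * (if j = 3 then 0 else 1) - (if j = 3 then x' $ 3 else 0)) x =
      (if i = j then - 1 else 0)" for i j
  proof -
    have "((\<lambda>x'. (X - x') $ j * (if j = 3 then 0 else 1) - (if j = 3 then x' $ 3 else 0)) has_derivative
        (\<lambda>h. - (h $ j))) (at x)"
      by (auto intro!: derivative_eq_intros bounded_linear.has_derivative[OF bounded_linear_vec_nth])
    from pderivative_eqI[OF this] show ?thesis by (auto simp: axis_def)
  qed
  ultimately show ?thesis
    by (simp add: mixed_derivs_def mat_def vec_eq_iff)
qed

lemma mat_minus_1:
  fixes x :: "real ^ 'n"
  shows "- mat (- 1) = (mat 1 :: real ^ 'n ^ 'n)" "mat (- 1) *v x = - x" "x v* mat (- 1) = - x"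
    "\<bar>det (mat (- 1) :: real ^ 3 ^ 3)\<bar> = 1"
proof -
  show *: "- mat (- 1) = (mat 1 :: real ^ 'n ^ 'n)"
    by (simp add: mat_def vec_eq_iff)
  show "mat (- 1) *v x = - x" "x v* mat (- 1) = - x"
    by (simp_all add: mat_def vec_eq_iff matrix_vector_mult_def vector_matrix_mult_def
        if_distrib[where f = "\<lambda>a. a * _"] if_distrib[where f = "\<lambda>a. _ * a"] cong: if_cong)
  show "\<bar>det (mat (- 1) :: real ^ 3 ^ 3)\<bar> = 1"
    by (simp add: det_3 mat_def)
qed

lemma omega_cost_apply: "omega cost p v = fst (v 0) \<bullet> snd (v 1) - snd (v 0) \<bullet> fst (v 1)"
  by (simp add: omega_def mixed_derivs_cost block_form_def mat_minus_1)

lemma omega_cost: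
  "omega cost p = (\<lambda>v. wedge_list [x_coord 1, X_coord 1] v + wedge_list [x_coord 2, X_coord 2] v +
     wedge_list [x_coord 3, X_coord 3] v)"
  by (rule ext) (simp add: omega_cost_apply wedge_list_2 x_coord_def X_coord_def inner_vec_def sum_3 algebra_simps)

lemma differential_linear: "bounded_linear f \<Longrightarrow> differential f p = wedge_list [f]"
  using frechet_derivative_at[OF bounded_linear_imp_has_derivative[of f "at p"]]
  by (auto simp: differential_def wedge_list_1 fun_eq_iff)

lemma bounded_linear_coords:
  "bounded_linear (x_coord i)" "bounded_linear (X_coord i)"
  unfolding x_coord_def[abs_def] X_coord_def[abs_def]
  by (auto intro: bounded_linear_compose[OF bounded_linear_vec_nth] bounded_linear_fst bounded_linear_snd)

lemma wedge_wedge_list_1_1: "wedge 1 1 (wedge_list [f]) (wedge_list [g]) = wedge_list [f, g]"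
  and wedge_wedge_list_1_2: "wedge 1 2 (wedge_list [f]) (wedge_list [g, h]) = wedge_list [f, g, h]"
  and wedge_wedge_list_2_2:
    "wedge 2 2 (wedge_list [f, g]) (wedge_list [h, i]) = wedge_list [f, g, h, i]"
  and wedge_wedge_list_2_3:
    "wedge 2 3 (wedge_list [f, g]) (wedge_list [h, i, j]) = wedge_list [f, g, h, i, j]"
  and wedge_wedge_list_4_2:
    "wedge 4 2 (wedge_list [f, g, h, i]) (wedge_list [j, k]) = wedge_list [f, g, h, i, j, k]"
  using wedge_wedge_list[of "[f]" "[g]"] wedge_wedge_list[of "[f]" "[g, h]"]
    wedge_wedge_list[of "[f, g]" "[h, i]"] wedge_wedge_list[of "[f, g]" "[h, i, j]"]
    wedge_wedge_list[of "[f, g, h, i]" "[j, k]"]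
  by (simp_all add: numeral_eq_Suc)

lemma omega_cost_canonical:
  "omega cost p = (\<lambda>v.
     wedge 1 1 (differential (\<lambda>q. fst q $ 1) p) (differential (\<lambda>q. snd q $ 1) p) v +
     wedge 1 1 (differential (\<lambda>q. fst q $ 2) p) (differential (\<lambda>q. snd q $ 2) p) v +
     wedge 1 1 (differential (\<lambda>q. fst q $ 3) p) (differential (\<lambda>q. snd q $ 3) p) v)"
  unfolding x_coord_def[symmetric] X_coord_def[symmetric]
  by (simp only: differential_linear bounded_linear_coords wedge_wedge_list_1_1 omega_cost)

text \<open>2-forms commute: exchanging two neighbouring pairs of factors takes two transpositions,
  and the signs cancel.\<close>

lemma wedge_list_block_swap_12:
  "wedge_list [a, b, c, d, e, f] v = wedge_list [c, d, a, b, e, f] v"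
  using wedge_list_swap[of 0 "[a, b, c, d, e, f]" 2 v] wedge_list_swap[of 1 "[c, b, a, d, e, f]" 3 v]
  by (simp add: numeral_eq_Suc)

lemma wedge_list_block_swap_23:
  "wedge_list [a, b, c, d, e, f] v = wedge_list [a, b, e, f, c, d] v"
  using wedge_list_swap[of 2 "[a, b, c, d, e, f]" 4 v] wedge_list_swap[of 3 "[a, b, e, d, c, f]" 5 v]
  by (simp add: numeral_eq_Suc)

lemma wedge_list_swap_middle:
  "wedge_list [a, b, c, d, e, f] v = - wedge_list [a, c, b, d, e, f] v"
  using wedge_list_swap[of 1 "[a, b, c, d, e, f]" 2 v] by (simp add: numeral_eq_Suc)

text \<open>With each coordinate next to its conjugate, this is \<omega>^3 / 3! without a
  sign.\<close>

abbreviation (input) symplectic_volume :: "(R3 \<times> R3) covector" where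
  "symplectic_volume \<equiv>
     wedge_list [x_coord 1, X_coord 1, x_coord 2, X_coord 2, x_coord 3, X_coord 3]"

text \<open>The premise lists the five orders of the three blocks other than 1, 2, 3; leaving out
  the sorted order keeps the rewriting from looping.\<close>

lemma wedge_list_blocks:
  fixes v :: "nat \<Rightarrow> R3 \<times> R3"
  assumes "i = (1::3) \<and> j = 3 \<and> k = 2 \<or> i = 2 \<and> j = 1 \<and> k = 3 \<or>
    i = 2 \<and> j = 3 \<and> k = 1 \<or> i = 3 \<and> j = 1 \<and> k = 2 \<or> i = 3 \<and> j = 2 \<and> k = 1"
  shows "wedge_list [x_coord i, X_coord i, x_coord j, X_coord j, x_coord k, X_coord k] v =
    symplectic_volume v"
  using wedge_list_block_swap_12[of "x_coord 1" "X_coord 1" "x_coord 2" "X_coord 2" "x_coord 3" "X_coord 3" v]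
    wedge_list_block_swap_12[of "x_coord 1" "X_coord 1" "x_coord 3" "X_coord 3" "x_coord 2" "X_coord 2" v]
    wedge_list_block_swap_12[of "x_coord 2" "X_coord 2" "x_coord 3" "X_coord 3" "x_coord 1" "X_coord 1" v]
    wedge_list_block_swap_23[of "x_coord 1" "X_coord 1" "x_coord 2" "X_coord 2" "x_coord 3" "X_coord 3" v]
    wedge_list_block_swap_23[of "x_coord 2" "X_coord 2" "x_coord 1" "X_coord 1" "x_coord 3" "X_coord 3" v]
  using assms by (elim disjE conjE) simp_all

text \<open>Of the 27 products of summands of \<omega>, only the 3! orderings of the three distinct
  blocks have no repeated factor, and all six are equal.\<close>

lemma omega_cost_cubed:
  "wedge 4 2 (wedge 2 2 (omega cost p) (omega cost p)) (omega cost p) v / fact 3 = symplectic_volume v"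
  by (simp add: omega_cost wedge_add_left wedge_add_right wedge_wedge_list_2_2
      wedge_wedge_list_4_2 wedge_list_not_distinct wedge_list_blocks fact_numeral)

lemma symplectic_volume_nonzero: "\<exists>v. symplectic_volume v \<noteq> 0"
proof
  \<comment> \<open>The basis dual to the six factors: the determinant becomes that of the identity
    matrix, where only the identity permutation contributes.\<close>
  define b :: "nat \<Rightarrow> R3 \<times> R3" where
    "b i = [(axis 1 1, 0), (0, axis 1 1), (axis 2 1, 0), (0, axis 2 1), (axis 3 1, 0), (0, axis 3 1)] ! i" for i
  define fs :: "(R3 \<times> R3 \<Rightarrow> real) list" where
    "fs = [x_coord 1, X_coord 1, x_coord 2, X_coord 2, x_coord 3, X_coord 3]"
  have dual: "(fs ! i) (b j) = (if i = j then 1 else 0)" if "i < 6" "j < 6" for i j :: nat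
    using that unfolding fs_def b_def
    by (auto simp: numeral_eq_Suc less_Suc_eq axis_def x_coord_def X_coord_def)
  have "(\<Prod>i<6::nat. (fs ! i) (b (\<sigma> i))) = (if \<sigma> = id then 1 else 0)" if \<sigma>: "\<sigma> permutes {..<6::nat}" for \<sigma>
  proof (cases "\<sigma> = id")
    case False
    then obtain i where "\<sigma> i \<noteq> i" by (auto simp: fun_eq_iff)
    then have "i < 6" using permutes_not_in[OF \<sigma>, of i] by auto
    moreover have "\<sigma> i < 6" using \<open>i < 6\<close> permutes_in_image[OF \<sigma>, of i] by simp
    ultimately show ?thesis using \<open>\<sigma> i \<noteq> i\<close> False
      by (auto intro!: prod_zero bexI[of _ i] simp: dual)
  qed (simp add: dual)
  then have *: "of_int (sign \<sigma>) * (\<Prod>i<6. (fs ! i) (b (\<sigma> i))) = (if \<sigma> = id then 1 else 0)"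
    if "\<sigma> permutes {..<6}" for \<sigma>
    using that by simp
  have "length fs = 6" by (simp add: fs_def)
  then have "wedge_list fs b = (\<Sum>\<sigma> | \<sigma> permutes {..<6::nat}. if \<sigma> = id then 1 else 0)"
    unfolding wedge_list_def by (simp only:) (intro sum.cong refl *, simp)
  also have "\<dots> = 1"
    by (subst sum.delta) (auto intro: finite_permutations permutes_id)
  finally show "symplectic_volume b \<noteq> 0"
    by (simp add: fs_def)
qed

section \<open>The Monge-Ampere form and its contractions\<close>

definition canonical_form :: "(R3 \<Rightarrow> real) \<Rightarrow> (R3 \<Rightarrow> real) \<Rightarrow> R3 \<times> R3 \<Rightarrow> (R3 \<times> R3) covector" where
  "canonical_form \<rho> \<rho>' p v =
     \<rho>' (snd p) * wedge_list [X_coord 1, X_coord 2, X_coord 3] v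
     - \<rho> (fst p) * wedge_list [x_coord 1, x_coord 2, x_coord 3] v"

text \<open>Each summand of \<omega> contains one \<open>x_coord\<close> and one
  \<open>X_coord\<close>, hence shares a factor with either term of the form.\<close>

lemma canonical_form_effective: "wedge 2 3 (omega cost p) (canonical_form \<rho> \<rho>' p) v = 0"
  unfolding canonical_form_def[abs_def]
  by (simp add: omega_cost wedge_add_left wedge_diff_right wedge_scale_right
      wedge_wedge_list_2_3 wedge_list_not_distinct)

lemma interior_product_wedge_list_3:
  "interior_product V (wedge_list [f, g, h]) v =
     f V * wedge_list [g, h] v - g V * wedge_list [f, h] v + h V * wedge_list [f, g] v"
  by (simp add: interior_product_def wedge_list_3 wedge_list_2 numeral_2_eq_2 algebra_simps)

lemma interior_product_canonical_form:
  "interior_product V (canonical_form \<rho> \<rho>' p) = (\<lambda>v.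
     \<rho>' (snd p) * snd V $ 1 * wedge_list [X_coord 2, X_coord 3] v
   - \<rho>' (snd p) * snd V $ 2 * wedge_list [X_coord 1, X_coord 3] v
   + \<rho>' (snd p) * snd V $ 3 * wedge_list [X_coord 1, X_coord 2] v
   - \<rho> (fst p) * fst V $ 1 * wedge_list [x_coord 2, x_coord 3] v
   + \<rho> (fst p) * fst V $ 2 * wedge_list [x_coord 1, x_coord 3] v
   - \<rho> (fst p) * fst V $ 3 * wedge_list [x_coord 1, x_coord 2] v)" (is "_ = ?rhs")
proof
  fix v
  have "interior_product V (canonical_form \<rho> \<rho>' p) v =
      \<rho>' (snd p) * interior_product V (wedge_list [X_coord 1, X_coord 2, X_coord 3]) v -
      \<rho> (fst p) * interior_product V (wedge_list [x_coord 1, x_coord 2, x_coord 3]) v"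
    by (simp add: interior_product_def canonical_form_def)
  then show "interior_product V (canonical_form \<rho> \<rho>' p) v = ?rhs v"
    by (simp add: interior_product_wedge_list_3 x_coord_def X_coord_def algebra_simps)
qed

text \<open>Sorting into conjugate pairs takes one transposition of the middle factors. The
  resulting sign cancels the minus sign in \<open>canonical_form\<close>.\<close>

lemma wedge_list_pairs:
  fixes v :: "nat \<Rightarrow> R3 \<times> R3"
  assumes "i = (1::3) \<and> j = 2 \<and> k = 3 \<or> i = 1 \<and> j = 3 \<and> k = 2 \<or> i = 2 \<and> j = 3 \<and> k = 1"
  shows "wedge_list [x_coord i, x_coord j, X_coord i, X_coord j, x_coord k, X_coord k] v =
      - symplectic_volume v"
    and "wedge_list [X_coord i, X_coord j, x_coord i, x_coord j, x_coord k, X_coord k] v =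
      - symplectic_volume v"
proof -
  show *: "wedge_list [x_coord i, x_coord j, X_coord i, X_coord j, x_coord k, X_coord k] v =
      - symplectic_volume v"
    using assms by (subst wedge_list_swap_middle) (auto simp: wedge_list_blocks)
  show "wedge_list [X_coord i, X_coord j, x_coord i, x_coord j, x_coord k, X_coord k] v =
      - symplectic_volume v"
    using * by (subst wedge_list_block_swap_12)
qed

text \<open>Two index pairs out of {1, 2, 3} overlap, so products of two x-pairs or of two X-pairs
  vanish. In a mixed product, the summand of \<omega> with index k survives only if both pairs omit
  k. This leaves the components of V and W with equal index k.\<close>

lemma interior_products_wedge_omega:
  "wedge 4 2 (wedge 2 2 (interior_product V (canonical_form \<rho> \<rho>' p))
       (interior_product W (canonical_form \<rho> \<rho>' p))) (omega cost p) v =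
   \<rho> (fst p) * \<rho>' (snd p) * (fst V \<bullet> snd W + snd V \<bullet> fst W) * symplectic_volume v"
  unfolding interior_product_canonical_form omega_cost
  by (simp add: wedge_add_left wedge_add_right wedge_diff_left wedge_diff_right
      wedge_scale_left wedge_scale_right wedge_wedge_list_2_2
      wedge_wedge_list_4_2 wedge_list_not_distinct wedge_list_pairs inner_vec_def sum_3 x_coord_def X_coord_def)
    (simp add: algebra_simps)

lemma lychagin_rubtsov_canonical_form:
  assumes "\<alpha> p = canonical_form \<rho> \<rho>' p"
  shows "lychagin_rubtsov (omega cost) \<alpha> p V W =
    \<rho> (fst p) * \<rho>' (snd p) * (fst V \<bullet> snd W + snd V \<bullet> fst W)"
  unfolding lychagin_rubtsov_def assms omega_cost_cubed interior_products_wedge_omega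
  using symplectic_volume_nonzero by (intro the_equality) auto

lemma kim_mccann_warren_cost:
  "kim_mccann_warren cost \<rho> \<rho>' p V W =
     (\<rho> (fst p) * \<rho>' (snd p)) powr (1 / 3) * (fst V \<bullet> snd W + snd V \<bullet> fst W)"
  by (simp add: kim_mccann_warren_def mixed_derivs_cost block_form_def mat_minus_1)

section \<open>Effective 3-covectors\<close>

text \<open>W stands for \<omega> and C for a 3-covector on five fixed vectors, of which the last is
  \<omega>-orthogonal to the others. Only the conjugate pairs {0, 1} and {2, 3} can fill the slots
  of W; each occurs in 2! 3! = 12 permutations with equal contributions, and 12 is also the
  denominator in \<open>wedge 2 3\<close>.\<close>

lemma sum_permutations_5:
  fixes W :: "nat \<Rightarrow> nat \<Rightarrow> real" and C :: "nat \<Rightarrow> nat \<Rightarrow> nat \<Rightarrow> real"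
  assumes C: "\<And>i j k. C i j k = - C j i k" "\<And>i j k. C i j k = - C i k j"
    and W: "W 0 1 = 1" "W 1 0 = - 1" "W 2 3 = 1" "W 3 2 = - 1"
      "W 0 2 = 0" "W 0 3 = 0" "W 0 4 = 0" "W 1 2 = 0" "W 1 3 = 0" "W 1 4 = 0"
      "W 2 0 = 0" "W 2 1 = 0" "W 2 4 = 0" "W 3 0 = 0" "W 3 1 = 0" "W 3 4 = 0"
      "W 4 0 = 0" "W 4 1 = 0" "W 4 2 = 0" "W 4 3 = 0"
  shows "(\<Sum>\<sigma> | \<sigma> permutes {..<5}. of_int (sign \<sigma>) * W (\<sigma> 0) (\<sigma> 1) * C (\<sigma> 2) (\<sigma> 3) (\<sigma> 4)) =
    12 * (C 2 3 4 + C 0 1 4)"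
proof -
  have s: "{..<5::nat} = insert 0 (insert 1 (insert 2 (insert 3 {4})))" by auto
  have C': "C 2 4 3 = - C 2 3 4" "C 3 2 4 = - C 2 3 4" "C 3 4 2 = C 2 3 4" "C 4 2 3 = C 2 3 4"
    "C 4 3 2 = - C 2 3 4" "C 0 4 1 = - C 0 1 4" "C 1 0 4 = - C 0 1 4" "C 1 4 0 = C 0 1 4"
    "C 4 0 1 = C 0 1 4" "C 4 1 0 = - C 0 1 4"
    using C(1)[of 3 2 4] C(2)[of 2 4 3] C(2)[of 3 4 2] C(1)[of 4 2 3] C(1)[of 4 3 2]
      C(1)[of 1 0 4] C(2)[of 0 4 1] C(2)[of 1 4 0] C(1)[of 4 0 1] C(1)[of 4 1 0] by simp_all
  show ?thesis
    unfolding s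
    by (simp add: sum_over_permutations_insert permutes_sing sign_swap_id sign_compose
        permutation_swap_id permutation_compose Transposition.transpose_def W W[unfolded One_nat_def] C' C'[unfolded One_nat_def])
qed

section \<open>Alternating 3-covectors as trilinear functions\<close>

abbreviation (input) triple :: "'v \<Rightarrow> 'v \<Rightarrow> 'v \<Rightarrow> nat \<Rightarrow> 'v" where
  "triple x y z \<equiv> case_nat x (case_nat y (\<lambda>_. z))"

lemma less_3_iff: "i < 3 \<longleftrightarrow> i = 0 \<or> i = 1 \<or> i = (2::nat)"
  by auto

lemma alternating_3_triple:
  assumes "alternating 3 a"
  shows "a v = a (triple (v 0) (v 1) (v 2))"
  using assms unfolding alternating_def
  by (auto simp: less_3_iff numeral_2_eq_2)

lemma alternating_3_linear:
  assumes "alternating 3 a"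
  shows "linear (\<lambda>x. a (triple x y z))" "linear (\<lambda>y. a (triple x y z))" "linear (\<lambda>z. a (triple x y z))"
proof -
  have lin: "linear (\<lambda>w. a (v(i := w)))" if "i < 3" for v i
    using assms that unfolding alternating_def by blast
  \<comment> \<open>The placeholder u is overwritten by the update. In the third slot it survives in
    the tail of the sequence, which a 3-covector ignores; hence the detour through
    \<open>alternating_3_triple\<close>.\<close>
  have "a (triple x y z) = a ((triple u y z)(0 := x))"
    "a (triple x y z) = a ((triple x u z)(1 := y))"
    "a (triple x y z) = a ((triple x y u)(2 := z))" for x y z u
    by (subst (1 2) alternating_3_triple[OF assms], simp add: numeral_2_eq_2)+
  then show "linear (\<lambda>x. a (triple x y z))" "linear (\<lambda>y. a (triple x y z))" "linear (\<lambda>z. a (triple x y z))"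
    using lin[of 0 "triple undefined y z"] lin[of 1 "triple x undefined z"] lin[of 2 "triple x y undefined"]
    by simp_all
qed

text \<open>Polarisation: expand the vanishing value at a repeated argument x + y.\<close>

lemma alternating_3_swap:
  assumes "alternating 3 a"
  shows "a (triple x y z) = - a (triple y x z)" "a (triple x y z) = - a (triple x z y)"
proof -
  note lin = alternating_3_linear[OF assms, THEN linear_add]
  have rep: "a v = 0" if "i < 3" "j < 3" "i \<noteq> j" "v i = v j" for v i j
    using assms that unfolding alternating_def by blast
  have "a (triple (x + y) (x + y) z) = 0" "a (triple x x z) = 0" "a (triple y y z) = 0"
    by (rule rep[of 0 1]; simp)+
  then show "a (triple x y z) = - a (triple y x z)"
    by (simp add: lin)
  have "a (triple x (y + z) (y + z)) = 0" "a (triple x y y) = 0" "a (triple x z z) = 0"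
    by (rule rep[of 1 2]; simp add: numeral_2_eq_2)+
  then show "a (triple x y z) = - a (triple x z y)"
    by (simp add: lin)
qed

lemma alternating_3_wedge_list:
  fixes f g h :: "'v::real_vector \<Rightarrow> real"
  assumes "linear f" "linear g" "linear h"
  shows "alternating 3 (wedge_list [f, g, h])"
  unfolding alternating_def
proof (intro conjI allI impI)
  fix v w :: "nat \<Rightarrow> 'v" assume "\<forall>i<3. v i = w i"
  then show "wedge_list [f, g, h] v = wedge_list [f, g, h] w"
    by (simp add: wedge_list_3)
next
  fix v :: "nat \<Rightarrow> 'v" and i :: nat assume "i < 3"
  then show "linear (\<lambda>y. wedge_list [f, g, h] (v(i := y)))"
    using assms[THEN linear_add] assms[THEN linear_scale]
    by (intro linearI) (auto simp: wedge_list_3 less_3_iff algebra_simps)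
next
  fix v :: "nat \<Rightarrow> 'v" and i j :: nat assume "i < 3" "j < 3" "i \<noteq> j \<and> v i = v j"
  then show "wedge_list [f, g, h] v = 0"
    by (auto simp: wedge_list_3 less_3_iff algebra_simps)
qed

lemma alternating_diff:
  fixes a b :: "'v::real_vector covector"
  assumes "alternating k a" "alternating k b"
  shows "alternating k (\<lambda>v. a v - b v)"
  unfolding alternating_def
proof (intro conjI allI impI)
  fix v w :: "nat \<Rightarrow> 'v" assume "\<forall>i<k. v i = w i"
  then show "a v - b v = a w - b w"
    using assms unfolding alternating_def by metis
next
  fix v :: "nat \<Rightarrow> 'v" and i :: nat assume "i < k"
  then show "linear (\<lambda>y. a (v(i := y)) - b (v(i := y)))"
    using assms unfolding alternating_def by (intro linear_compose_sub) blast+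
next
  fix v :: "nat \<Rightarrow> 'v" and i j :: nat assume "i < k" "j < k" "i \<noteq> j \<and> v i = v j"
  then have "a v = 0" "b v = 0"
    using assms unfolding alternating_def by blast+
  then show "a v - b v = 0" by simp
qed

lemma alternating_scale:
  fixes a :: "'v::real_vector covector"
  assumes "alternating k a"
  shows "alternating k (\<lambda>v. c * a v)"
  unfolding alternating_def
proof (intro conjI allI impI)
  fix v w :: "nat \<Rightarrow> 'v" assume "\<forall>i<k. v i = w i"
  then show "c * a v = c * a w"
    using assms unfolding alternating_def by metis
next
  fix v :: "nat \<Rightarrow> 'v" and i :: nat assume "i < k"
  then have "linear (\<lambda>y. a (v(i := y)))"
    using assms unfolding alternating_def by blast
  from linear_compose_scale_right[OF this, of c]
  show "linear (\<lambda>y. c * a (v(i := y)))" by simp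
next
  fix v :: "nat \<Rightarrow> 'v" and i j :: nat assume "i < k" "j < k" "i \<noteq> j \<and> v i = v j"
  then show "c * a v = 0"
    using assms unfolding alternating_def by simp
qed

lemma alternating_canonical_form: "alternating 3 (canonical_form \<rho> \<rho>' p)"
  unfolding canonical_form_def[abs_def]
  by (intro alternating_diff alternating_scale alternating_3_wedge_list
      bounded_linear_coords[THEN bounded_linear.linear])

section \<open>Effectiveness in a symplectic basis\<close>

abbreviation (input) x_vec :: "3 \<Rightarrow> R3 \<times> R3" where
  "x_vec i \<equiv> (axis i 1, 0)"

abbreviation (input) X_vec :: "3 \<Rightarrow> R3 \<times> R3" where
  "X_vec i \<equiv> (0, axis i 1)"

text \<open>Effectiveness says that the contraction of a with \<omega> vanishes. The identity is
  \<omega> \<and> a evaluated on the conjugate pairs of i and j together with w, which is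
  \<omega>-orthogonal to both pairs because k differs from i and j.\<close>

lemma effective_contraction:
  assumes alt: "alternating 3 a" and eff: "\<And>v. wedge 2 3 (omega cost p) a v = 0"
    and dist: "i \<noteq> j" "i \<noteq> k" "j \<noteq> k" and w: "w = x_vec k \<or> w = X_vec k"
  shows "a (triple (x_vec i) (X_vec i) w) + a (triple (x_vec j) (X_vec j) w) = 0"
proof -
  define v :: "nat \<Rightarrow> R3 \<times> R3" where "v n = [x_vec i, X_vec i, x_vec j, X_vec j, w] ! n" for n
  define W where "W m n = omega cost p (triple (v m) (v n) w)" for m n
  define C where "C l m n = a (triple (v l) (v m) (v n))" for l m n
  have vs: "v 0 = x_vec i" "v 1 = X_vec i" "v 2 = x_vec j" "v 3 = X_vec j" "v 4 = w"
    by (simp_all add: v_def numeral_eq_Suc)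
  have "wedge 2 3 (omega cost p) a v * 12 =
    (\<Sum>\<sigma> | \<sigma> permutes {..<5}. of_int (sign \<sigma>) * W (\<sigma> 0) (\<sigma> 1) * C (\<sigma> 2) (\<sigma> 3) (\<sigma> 4))"
    using alternating_3_triple[OF alt, of "\<lambda>i. v (\<sigma> (2 + i))" for \<sigma>]
    by (simp add: wedge_def W_def C_def omega_cost_apply fact_numeral)
  also have "\<dots> = 12 * (C 2 3 4 + C 0 1 4)"
  proof (rule sum_permutations_5)
    show "C l m n = - C m l n" "C l m n = - C l n m" for l m n
      unfolding C_def by (rule alternating_3_swap[OF alt])+
  qed (use dist w in \<open>auto simp: W_def omega_cost_apply vs vs(2)[unfolded One_nat_def] inner_axis_axis\<close>)
  finally show ?thesis
    by (simp add: eff C_def vs vs(2)[unfolded One_nat_def])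
qed

text \<open>
  The graphs of the diagonal 0/1 matrices determine the components without a conjugate pair;
  those of the swaps of two axes give \<open>a (x_vec i, X_vec i, _) = a (x_vec j, X_vec j, _)\<close>, whereas effectiveness gives
  the same equation with the opposite sign.
\<close>

lemma effective_zero_on_graphs_imp_zero:
  fixes a :: "(R3 \<times> R3) covector"
  assumes alt: "alternating 3 a" and eff: "\<And>v. wedge 2 3 (omega cost p) a v = 0"
    and graph: "\<And>(A :: real ^ 3 ^ 3) v. transpose A = A \<Longrightarrow> a (\<lambda>i. (v i, A *v v i)) = 0"
  shows "a v = 0"
proof -
  define B where "B x y z = a (triple x y z)" for x y z
  note lin = alternating_3_linear[OF alt, folded B_def]
  note B_add = lin[THEN linear_add]
  note swap = alternating_3_swap[OF alt, folded B_def]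
  have zero: "B 0 y z = 0" "B x 0 z = 0" "B x y 0 = 0" for x y z
    using lin[THEN linear_0] by auto
  have rep: "B x x z = 0" "B x y y = 0" "B x y x = 0" for x y z
    using swap(1)[of x x z] swap(2)[of x y y] swap(1)[of x y x] swap(2)[of y x x] by simp_all
  have cyclic: "B x y z = B y z x" for x y z
    using swap(1)[of x y z] swap(2)[of y x z] by linarith
  define E F :: "3 \<Rightarrow> R3 \<times> R3" where "E i = x_vec i" and "F i = X_vec i" for i
  have graph: "B (x, A *v x) (y, A *v y) (z, A *v z) = 0" if "transpose A = A" for A x y z
    using graph[OF that, of "triple x y z"] alternating_3_triple[OF alt, of "\<lambda>i. (triple x y z i, A *v triple x y z i)"]
    by (simp add: B_def numeral_2_eq_2)
  \<comment> \<open>The graph of the diagonal matrix with entries c is spanned by the vectors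
    \<open>E i + c i *\<^sub>R F i\<close>.\<close>
  have diag: "B (E i + c i *\<^sub>R F i) (E j + c j *\<^sub>R F j) (E k + c k *\<^sub>R F k) = 0" for c :: "3 \<Rightarrow> real" and i j k
  proof -
    define A :: "real ^ 3 ^ 3" where "A = (\<chi> r s. if r = s then c r else 0)"
    have "transpose A = A" by (auto simp: A_def transpose_def vec_eq_iff)
    moreover have "A *v axis l 1 = c l *\<^sub>R axis l 1" for l
      unfolding matrix_vector_mult_basis by (auto simp: A_def column_def vec_eq_iff axis_def)
    ultimately show ?thesis
      using graph[of A "axis i 1" "axis j 1" "axis k 1"] by (simp add: E_def F_def)
  qed
  have swapped: "B (E i + F j) (E j + F i) (E k + c *\<^sub>R F k) = 0"
    if "i \<noteq> j" "i \<noteq> k" "j \<noteq> k" for c i j k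
  proof -
    define A :: "real ^ 3 ^ 3" where
      "A = (\<chi> r s. if r = i \<and> s = j \<or> r = j \<and> s = i then 1 else if r = k \<and> s = k then c else 0)"
    have "transpose A = A" by (auto simp: A_def transpose_def vec_eq_iff)
    moreover have "A *v axis i 1 = axis j 1" "A *v axis j 1 = axis i 1" "A *v axis k 1 = c *\<^sub>R axis k 1"
      unfolding matrix_vector_mult_basis using that by (auto simp: A_def column_def vec_eq_iff axis_def)
    ultimately show ?thesis
      using graph[of A "axis i 1" "axis j 1" "axis k 1"] by (simp add: E_def F_def)
  qed
  have EEE: "B (E i) (E j) (E k) = 0" for i j k
    using diag[of i "\<lambda>_. 0" j k] by simp
  \<comment> \<open>The indicator of k as diagonal adds F k to E k alone; expanding leaves the
    wanted component and one already known to vanish.\<close>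
  have EEF_distinct: "B (E i) (E j) (F k) = 0" if "i \<noteq> k" "j \<noteq> k" for i j k
    using diag[of i "\<lambda>l. if l = k then 1 else 0" j k] that by (simp add: B_add EEE)
  have EFF_distinct: "B (E i) (F j) (F k) = 0" if "i \<noteq> j" "i \<noteq> k" "j \<noteq> k" for i j k
    using diag[of i "\<lambda>l. if l = i then 0 else 1" j k] that swap(2)[of "E i" "F j" "E k"]
    by (simp add: B_add EEE EEF_distinct)
  have FFF: "B (F i) (F j) (F k) = 0" for i j k
  proof (cases "i = j \<or> i = k \<or> j = k")
    case False
    then have d: "i \<noteq> j" "i \<noteq> k" "j \<noteq> k" by auto
    have "B (E i) (E j) (F k) = 0" "B (E i) (E k) (F j) = 0" "B (E j) (E k) (F i) = 0"
      "B (E i) (F j) (F k) = 0" "B (E j) (F i) (F k) = 0" "B (E k) (F i) (F j) = 0"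
      using d by (auto intro: EEF_distinct EFF_distinct)
    moreover from this have "B (E i) (F j) (E k) = 0" "B (F i) (E j) (E k) = 0"
        "B (F i) (E j) (F k) = 0" "B (F i) (F j) (E k) = 0"
      using swap(2)[of "E i" "F j" "E k"] cyclic[of "F i" "E j" "E k"]
        swap(1)[of "F i" "E j" "F k"] cyclic[of "E k" "F i" "F j"] by linarith+
    ultimately show ?thesis
      \<comment> \<open>The graph of the identity matrix: of the eight terms of the expansion, all
        but the one with three F are known to vanish.\<close>
      using diag[of i "\<lambda>_. 1" j k] by (simp add: B_add EEE)
  qed (auto simp: rep)
  have EF_pair: "B (E i) (F i) (E k) = 0 \<and> B (E i) (F i) (F k) = 0" if "i \<noteq> k" for i k
  proof -
    have "card {i, k} < CARD(3)"
      by (simp add: card_insert_if)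
    then obtain j where "j \<notin> {i, k}"
      by (metis UNIV_eq_I less_irrefl)
    then have d: "i \<noteq> j" "j \<noteq> k" by auto
    have "B (E i) (F i) (E k) + B (E j) (F j) (E k) = 0" "B (E i) (F i) (F k) + B (E j) (F j) (F k) = 0"
      using effective_contraction[OF alt eff d(1) that d(2)] unfolding B_def E_def F_def by auto
    \<comment> \<open>The entry c at k separates the two claims: c = 0 gives the relation with E k,
      and subtracting it from the case c = 1 gives the one with F k.\<close>
    moreover have swapped_0:
      "B (E i) (E j) (E k) + B (E i) (F i) (E k) + B (F j) (E j) (E k) + B (F j) (F i) (E k) = 0"
      using swapped[OF d(1) that d(2), of 0] by (simp add: B_add)
    moreover have
      "B (E i) (E j) (F k) + B (E i) (F i) (F k) + B (F j) (E j) (F k) + B (F j) (F i) (F k) = 0"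
      using swapped[OF d(1) that d(2), of 1] swapped_0 by (simp add: B_add)
    moreover have "B (E i) (E j) (F k) = 0" "B (E k) (F j) (F i) = 0"
      using d that by (auto intro: EEF_distinct EFF_distinct)
    ultimately show ?thesis
      using EEE[of i j k] FFF[of j i k] cyclic[of "E k" "F j" "F i"]
        swap(1)[of "F j" "E j" "E k"] swap(1)[of "F j" "E j" "F k"] by linarith
  qed
  have EEF: "B (E i) (E j) (F k) = 0" for i j k
  proof -
    consider "i = j" | "i \<noteq> j" "k = i" | "i \<noteq> j" "k = j" | "i \<noteq> k" "j \<noteq> k" by blast
    then show ?thesis
    proof cases
      case 2
      then show ?thesis
        using EF_pair[of i j] swap(2)[of "E i" "E j" "F i"] by simp
    next
      case 3
      then show ?thesis
        using EF_pair[of j i] cyclic[of "E i" "E j" "F j"] by simp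
    qed (simp_all add: rep EEF_distinct)
  qed
  have EFF: "B (E i) (F j) (F k) = 0" for i j k
  proof -
    consider "j = k" | "j \<noteq> k" "i = j" | "j \<noteq> k" "i = k" | "i \<noteq> j" "i \<noteq> k" "j \<noteq> k" by blast
    then show ?thesis
    proof cases
      case 2
      then show ?thesis using EF_pair[of j k] by simp
    next
      case 3
      then show ?thesis
        using EF_pair[of k j] swap(2)[of "E k" "F j" "F k"] by simp
    qed (simp_all add: rep EFF_distinct)
  qed
  have "B (E i) (F k) (E j) = 0" "B (F k) (E i) (E j) = 0"
      "B (F j) (E i) (F k) = 0" "B (F j) (F k) (E i) = 0" for i j k
    using EEF[of i j k] EEF[of j i k] EFF[of i j k] EFF[of i k j] swap(2)[of "E i" "F k" "E j"]
      cyclic[of "F k" "E i" "E j"] cyclic[of "F j" "E i" "F k"] cyclic[of "E i" "F j" "F k"]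
      cyclic[of "E i" "F k" "F j"] swap(1)[of "F j" "E i" "F k"]
    by linarith+
  note components = this EEE EEF EFF FFF
  have Basis: "b \<in> range E \<union> range F" if "b \<in> Basis" for b
    using that by (auto simp: Basis_prod_def Basis_vec_def E_def F_def)
  have on_Basis: "B x y z = 0" if "x \<in> Basis" "y \<in> Basis" "z \<in> Basis" for x y z
    using that[THEN Basis] by (auto simp: components)
  have "B x y z = 0" for x y z
  proof -
    \<comment> \<open>A linear function that vanishes on the basis is zero; this frees one argument
      after the other.\<close>
    have "B x y z = 0" if "y \<in> Basis" "z \<in> Basis" for x y z
      using linear_eq_stdbasis[OF lin(1)[of y z] linear_zero on_Basis[OF _ that]] by (rule fun_cong)
    then have "B x y z = 0" if "z \<in> Basis" for x y z
      using linear_eq_stdbasis[OF lin(2)[of x z] linear_zero] that by (auto dest: fun_cong)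
    then show ?thesis
      using linear_eq_stdbasis[OF lin(3)[of x y] linear_zero] by (auto dest: fun_cong)
  qed
  then show ?thesis
    by (subst alternating_3_triple[OF alt]) (simp add: B_def)
qed

section \<open>Sections of the cotangent bundle\<close>

lemma frechet_derivative_cart:
  fixes g :: "real ^ 'n \<Rightarrow> real"
  assumes "g differentiable (at x)"
  shows "(g has_derivative (\<lambda>h. \<Sum>i\<in>UNIV. h $ i * pderivative i g x)) (at x)"
proof -
  have der: "(g has_derivative frechet_derivative g (at x)) (at x)"
    using assms by (simp add: frechet_derivative_works)
  then have lin: "linear (frechet_derivative g (at x))"
    by (rule has_derivative_linear)
  have "frechet_derivative g (at x) h = (\<Sum>i\<in>UNIV. h $ i * pderivative i g x)" for h
  proof -
    have "frechet_derivative g (at x) (\<Sum>i\<in>UNIV. h $ i *\<^sub>R axis i 1) = (\<Sum>i\<in>UNIV. h $ i * pderivative i g x)"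
      by (simp add: linear_sum[OF lin] linear_scale[OF lin] pderivative_def)
    then show ?thesis
      using basis_expansion[of h] by (simp add: scalar_mult_eq_scaleR)
  qed
  then have "frechet_derivative g (at x) = (\<lambda>h. \<Sum>i\<in>UNIV. h $ i * pderivative i g x)" by blast
  with der show ?thesis by simp
qed

lemma has_derivative_vec_componentwise:
  fixes F :: "'a::real_normed_vector \<Rightarrow> real ^ 'n"
  assumes "\<And>i. ((\<lambda>x. F x $ i) has_derivative (\<lambda>h. F' h $ i)) (at x)"
  shows "(F has_derivative F') (at x)"
  using assms
  by (subst has_derivative_componentwise_within)
    (auto simp: Basis_vec_def inner_axis)

text \<open>The row index of \<open>hessian\<close> is that of the outer derivative, so the
  direction h multiplies from the left.\<close>

lemma has_derivative_grad:
  assumes "open U" "x \<in> U" "smooth_on U u"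
  shows "(grad u has_derivative (\<lambda>h. h v* hessian u x)) (at x)"
proof (rule has_derivative_vec_componentwise)
  fix i
  have "Ck_on (Suc (Suc 0)) U u"
    using assms(3) unfolding smooth_on_def by blast
  then have "pderivative i u differentiable_on U"
    by simp
  then have "pderivative i u differentiable (at x)"
    using assms(1,2) differentiable_on_eq_differentiable_at by blast
  from frechet_derivative_cart[OF this]
  show "((\<lambda>x. grad u x $ i) has_derivative (\<lambda>h. (h v* hessian u x) $ i)) (at x)"
    by (simp add: grad_def hessian_def vector_matrix_mult_def)
qed

text \<open>X is free because the Hessian of the cost is diag(1, 1, 0) for every X, which is the
  derivative of the shift (x, y, 0).\<close>

lemma has_derivative_du_section:
  assumes "open U" "x \<in> U" "smooth_on U u"
  shows "(du_section u has_derivative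
    (\<lambda>h. (h, h v* (hessian u x + hessian (\<lambda>x. cost x X) x)))) (at x)"
proof -
  have "((\<lambda>x :: R3. vector [x $ 1, x $ 2, 0] :: R3) has_derivative
      (\<lambda>h. h v* hessian (\<lambda>x. cost x X) x)) (at x)"
  proof (rule has_derivative_vec_componentwise)
    fix i :: 3
    show "((\<lambda>x :: R3. (vector [x $ 1, x $ 2, 0] :: R3) $ i) has_derivative
        (\<lambda>h. (h v* hessian (\<lambda>x. cost x X) x) $ i)) (at x)"
      using exhaust_3[of i]
      by (auto simp: hessian_cost vector_matrix_mult_def sum_3
          intro!: bounded_linear.has_derivative[OF bounded_linear_vec_nth] derivative_eq_intros)
  qed
  then have "((\<lambda>x. (x, grad u x + vector [x $ 1, x $ 2, 0])) has_derivative
    (\<lambda>h. (h, h v* hessian u x + h v* hessian (\<lambda>x. cost x X) x))) (at x)"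
    by (intro has_derivative_Pair has_derivative_ident has_derivative_add has_derivative_grad[OF assms])
  moreover have "h v* hessian u x + h v* hessian (\<lambda>x. cost x X) x =
      h v* (hessian u x + hessian (\<lambda>x. cost x X) x)" for h
    by (simp add: vector_matrix_mult_def vec_eq_iff algebra_simps sum.distrib)
  ultimately show ?thesis
    by (simp add: du_section_def[abs_def])
qed

lemma pullback_du_section:
  assumes "open U" "x \<in> U" "smooth_on U u"
  shows "pullback (du_section u) \<alpha> x v =
    \<alpha> (du_section u x) (\<lambda>i. (v i, v i v* (hessian u x + hessian (\<lambda>x. cost x X) x)))"
  unfolding pullback_def frechet_derivative_at[OF has_derivative_du_section[OF assms, of X], symmetric] ..

section \<open>Pulling the canonical form back to graphs\<close>

lemma wedge_list_components:
  fixes v :: "nat \<Rightarrow> R3"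
  shows "wedge_list [\<lambda>y. y $ 1, \<lambda>y. y $ 2, \<lambda>y. y $ 3] v = det (vector [v 0, v 1, v 2])"
  by (simp add: wedge_list_3 det_3 vector_3 algebra_simps)

lemma wedge_list_comp: "wedge_list (map (\<lambda>g. g \<circ> h) fs) v = wedge_list fs (\<lambda>i. h (v i))"
  by (simp add: wedge_list_def)

lemma det_vector_mult:
  "det (vector [x v* A, y v* A, z v* A] :: real ^ 3 ^ 3) = det (vector [x, y, z] :: real ^ 3 ^ 3) * det A"
proof -
  have "(vector [x v* A, y v* A, z v* A] :: real ^ 3 ^ 3) = vector [x, y, z] ** A"
  proof (intro vec_eq_iff[THEN iffD2] allI)
    fix i j :: 3
    show "(vector [x v* A, y v* A, z v* A] :: real ^ 3 ^ 3) $ i $ j = (vector [x, y, z] ** A) $ i $ j"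
      using exhaust_3[of i] by (auto simp: vector_matrix_mult_def matrix_matrix_mult_def mult.commute)
  qed
  then show ?thesis by (simp add: det_mul)
qed

text \<open>On the graph, dx \<and> dy \<and> dz is the determinant of the rows v, while dX \<and>
  dY \<and> dZ is that of the rows multiplied by A, hence det A times the former.\<close>

lemma canonical_form_graph:
  "canonical_form \<rho> \<rho>' p (\<lambda>i. (v i, v i v* A)) =
     (\<rho>' (snd p) * det A - \<rho> (fst p)) * wedge_list [\<lambda>y. y $ 1, \<lambda>y. y $ 2, \<lambda>y. y $ 3] v"
  using wedge_list_comp[of fst "[\<lambda>y. y $ 1, \<lambda>y. y $ 2, \<lambda>y. y $ 3]" "\<lambda>i. (v i, v i v* A)"]
    wedge_list_comp[of snd "[\<lambda>y. y $ 1, \<lambda>y. y $ 2, \<lambda>y. y $ 3]" "\<lambda>i. (v i, v i v* A)"]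
  by (simp add: canonical_form_def x_coord_def[abs_def] X_coord_def[abs_def] o_def
      wedge_list_components det_vector_mult algebra_simps)

lemma wedge_differentials:
  fixes x :: R3
  shows "wedge 1 2 (differential (\<lambda>y. y $ 1) x)
    (wedge 1 1 (differential (\<lambda>y. y $ 2) x) (differential (\<lambda>y. y $ 3) x)) =
   wedge_list [\<lambda>y. y $ 1, \<lambda>y. y $ 2, \<lambda>y. y $ 3]"
  by (simp only: differential_linear bounded_linear_vec_nth wedge_wedge_list_1_1 wedge_wedge_list_1_2)

lemma monge_ampere_form_canonical:
  "monge_ampere_form M M' \<rho> \<rho>' (restrict (canonical_form \<rho> \<rho>') (M \<times> M'))"
  unfolding monge_ampere_form_def
proof (intro conjI allI impI ballI)
  show "restrict (canonical_form \<rho> \<rho>') (M \<times> M') \<in> forms_on 3 (M \<times> M')"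
    by (auto simp: forms_on_def alternating_canonical_form)
  show "effective_on (M \<times> M') (omega cost) (restrict (canonical_form \<rho> \<rho>') (M \<times> M'))"
    by (simp add: effective_on_def canonical_form_effective)
next
  fix U u x
  assume U: "open U \<and> U \<subseteq> M \<and> smooth_on U u \<and> (\<forall>x\<in>U. snd (du_section u x) \<in> M')" and x: "x \<in> U"
  then have "du_section u x \<in> M \<times> M'" "fst (du_section u x) = x"
    by (auto simp: du_section_def)
  with U x show "let X = snd (du_section u x) in
      pullback (du_section u) (restrict (canonical_form \<rho> \<rho>') (M \<times> M')) x =
      (\<lambda>v. (\<rho>' X * det (hessian u x + hessian (\<lambda>x'. cost x' X) x) - \<rho> x) *
        wedge 1 2 (differential (\<lambda>y. y $ 1) x)
          (wedge 1 1 (differential (\<lambda>y. y $ 2) x) (differential (\<lambda>y. y $ 3) x)) v)"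
    unfolding Let_def wedge_differentials
    by (intro ext, subst pullback_du_section[of U _ _ _ _ "snd (du_section u x)"])
      (auto simp: canonical_form_graph)
qed

section \<open>Quadratic test functions\<close>

lemma Ck_on_const: "Ck_on k (U :: (real ^ 'a) set) (\<lambda>_. c)"
proof (induction k arbitrary: c)
  case (Suc k)
  have "pderivative i (\<lambda>_. c) = (\<lambda>_. 0)" for i :: 'a
    using pderivative_eqI[OF has_derivative_const] by blast
  with Suc show ?case by simp
qed simp

lemma Ck_on_SucI:
  fixes g :: "real ^ 'n \<Rightarrow> real"
  assumes g: "\<And>x. (g has_derivative g' x) (at x)"
    and "\<And>i. Ck_on k U (\<lambda>x. g' x (axis i 1))"
  shows "Ck_on (Suc k) U g"
proof -
  have "pderivative i g = (\<lambda>x. g' x (axis i 1))" for i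
    using pderivative_eqI[OF g] by blast
  moreover have "g differentiable_on U"
    unfolding differentiable_on_def differentiable_def using has_derivative_at_withinI[OF g] by blast
  ultimately show ?thesis
    using assms(2) by simp
qed

lemma Ck_on_mono: "Ck_on (Suc k) U g \<Longrightarrow> Ck_on k U g"
proof (induction k arbitrary: g)
  case 0
  then have "g differentiable_on U" by simp
  then show ?case
    unfolding Ck_on.simps(1) by (rule differentiable_imp_continuous_on)
next
  case (Suc k)
  have "g differentiable_on U" "Ck_on (Suc k) U (pderivative i g)" for i
    using iffD1[OF Ck_on.simps(2) Suc.prems] by blast+
  from this(1) Suc.IH[OF this(2)] show ?case
    unfolding Ck_on.simps(2) by blast
qed

definition quadratic :: "real ^ 'n \<Rightarrow> real ^ 'n ^ 'n \<Rightarrow> real ^ 'n \<Rightarrow> real" where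
  "quadratic b S x = b \<bullet> x + (x \<bullet> (S *v x)) / 2"

lemma has_derivative_quadratic:
  assumes "transpose S = S"
  shows "(quadratic b S has_derivative (\<lambda>h. (b + S *v x) \<bullet> h)) (at x)"
proof -
  have sym: "h \<bullet> (S *v x) = x \<bullet> (S *v h)" for h
  proof -
    have "h \<bullet> (S *v x) = (h v* S) \<bullet> x"
      by (rule dot_lmul_matrix[symmetric])
    also have "h v* S = S *v h"
      using transpose_matrix_vector[of S h] unfolding assms by (rule sym)
    finally show ?thesis
      by (simp only: inner_commute)
  qed
  have "((\<lambda>x. b \<bullet> x + (x \<bullet> (S *v x)) / 2) has_derivative
      (\<lambda>h. b \<bullet> h + (x \<bullet> (S *v h) + h \<bullet> (S *v x)) / 2)) (at x)"
    by (intro has_derivative_add has_derivative_inner_right has_derivative_inner has_derivative_ident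
        bounded_linear.has_derivative[OF bounded_linear_divide]
        bounded_linear.has_derivative[OF matrix_vector_mul_bounded_linear])
  moreover have "b \<bullet> h + (x \<bullet> (S *v h) + h \<bullet> (S *v x)) / 2 = (b + S *v x) \<bullet> h" for h
    unfolding sym[symmetric] inner_add_left by (simp add: inner_commute[of h])
  ultimately show ?thesis
    unfolding quadratic_def[abs_def] by simp
qed

lemma pderivative_quadratic:
  assumes "transpose S = S"
  shows "pderivative i (quadratic b S) = (\<lambda>x. (b + S *v x) $ i)"
  using pderivative_eqI[OF has_derivative_quadratic[OF assms]] by (auto simp: inner_axis)

lemma has_derivative_affine_nth:
  fixes S :: "real ^ 'n ^ 'n"
  shows "((\<lambda>x. (b + S *v x) $ i) has_derivative (\<lambda>h. (S *v h) $ i)) (at x)"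
proof -
  have "((\<lambda>x. b $ i + (S *v x) $ i) has_derivative (\<lambda>h. 0 + (S *v h) $ i)) (at x)"
    by (intro has_derivative_add has_derivative_const bounded_linear.has_derivative[OF bounded_linear_vec_nth]
        bounded_linear.has_derivative[OF matrix_vector_mul_bounded_linear] has_derivative_ident)
  then show ?thesis by simp
qed

text \<open>Second partial derivatives are constant, which settles every order from 2 on;
  \<open>Ck_on_mono\<close> descends to the lower ones.\<close>

lemma smooth_on_quadratic:
  assumes "transpose S = S"
  shows "smooth_on U (quadratic b S)"
proof -
  have "Ck_on (Suc (Suc k)) U (quadratic b S)" for k
  proof (rule Ck_on_SucI[OF has_derivative_quadratic[OF assms]])
    show "Ck_on (Suc k) U (\<lambda>x. (b + S *v x) \<bullet> axis i 1)" for i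
      unfolding inner_axis inner_real_def mult_1_right
      by (rule Ck_on_SucI[OF has_derivative_affine_nth Ck_on_const])
  qed
  then show ?thesis
    unfolding smooth_on_def using Ck_on_mono by blast
qed

lemma grad_quadratic:
  assumes "transpose S = S"
  shows "grad (quadratic b S) x = b + S *v x"
  by (simp add: grad_def pderivative_quadratic[OF assms] vec_eq_iff)

lemma hessian_quadratic:
  assumes "transpose S = S"
  shows "hessian (quadratic b S) x = S"
proof -
  have "pderivative i (pderivative j (quadratic b S)) x = S $ i $ j" for i j
  proof -
    have "pderivative i (pderivative j (quadratic b S)) x = transpose S $ i $ j"
      unfolding pderivative_quadratic[OF assms] pderivative_eqI[OF has_derivative_affine_nth]
        matrix_vector_mult_basis
      by (simp add: column_def transpose_def)
    then show ?thesis by (simp add: assms)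
  qed
  then show ?thesis by (simp add: hessian_def vec_eq_iff)
qed

section \<open>Uniqueness of the form and the comparison of the metrics\<close>

lemma monge_ampere_form_on_graphs:
  assumes M: "open M" "open M'" and \<alpha>: "monge_ampere_form M M' \<rho> \<rho>' \<alpha>" and p: "p \<in> M \<times> M'"
    and A: "transpose A = A"
  shows "\<alpha> p (\<lambda>i. (v i, v i v* A)) =
    (\<rho>' (snd p) * det A - \<rho> (fst p)) * wedge_list [\<lambda>y. y $ 1, \<lambda>y. y $ 2, \<lambda>y. y $ 3] v"
proof -
  obtain x X where p_eq: "p = (x, X)" and x: "x \<in> M" and X: "X \<in> M'"
    using p by auto
  define D :: "real ^ 3 ^ 3" where "D = hessian (\<lambda>x. cost x X) x"
  \<comment> \<open>The slope of the section is the Hessian of u plus D, so u must have Hessian A -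
    D.\<close>
  define S where "S = A - D"
  have D: "transpose D = D"
    by (auto simp: D_def hessian_cost transpose_def vec_eq_iff)
  have S: "transpose S = S"
    using A D unfolding S_def by (simp add: transpose_def vec_eq_iff)
  \<comment> \<open>Solves \<open>grad u x + vector [x $ 1, x $ 2, 0] = X\<close>, so that the
    section passes through p.\<close>
  define b where "b = X - vector [x $ 1, x $ 2, 0] - S *v x"
  define u where "u = quadratic b S"
  have section_x: "du_section u x = p"
    by (simp add: du_section_def u_def grad_quadratic[OF S] b_def p_eq)
  \<comment> \<open>The fibre component is affine in y. The points of M whose image stays in M' thus
    form an open set, an admissible domain for u.\<close>
  have "snd (du_section u y) = b + S *v y + D *v y" for y
    by (auto simp: du_section_def u_def grad_quadratic[OF S] vec_eq_iff forall_3 vector_3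
        D_def hessian_cost matrix_vector_mult_def sum_3)
  then have "continuous_on UNIV (\<lambda>y. snd (du_section u y))"
    by (simp add: continuous_on_add linear_continuous_on matrix_vector_mul_bounded_linear)
  then have "open ((\<lambda>y. snd (du_section u y)) -` M')"
    using M(2) by (rule open_vimage[rotated])
  then have U: "open (M \<inter> (\<lambda>y. snd (du_section u y)) -` M')" (is "open ?U")
    using M(1) by auto
  have x_U: "x \<in> ?U"
    using x X section_x by (auto simp: p_eq)
  have smooth: "smooth_on ?U u"
    unfolding u_def by (rule smooth_on_quadratic[OF S])
  have "\<forall>y\<in>?U. pullback (du_section u) \<alpha> y = (\<lambda>v. (\<rho>' (snd (du_section u y)) *
      det (hessian u y + hessian (\<lambda>x'. cost x' (snd (du_section u y))) y) - \<rho> y) *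
      wedge_list [\<lambda>y. y $ 1, \<lambda>y. y $ 2, \<lambda>y. y $ 3] v)"
    using \<alpha> unfolding monge_ampere_form_def wedge_differentials Let_def
    by (elim conjE allE[of _ ?U] allE[of _ u], elim mp) (use U smooth in auto)
  then have "pullback (du_section u) \<alpha> x = (\<lambda>v. (\<rho>' X * det (hessian u x + D) - \<rho> x) *
      wedge_list [\<lambda>y. y $ 1, \<lambda>y. y $ 2, \<lambda>y. y $ 3] v)"
    using x_U section_x unfolding D_def by (auto simp: p_eq)
  moreover have "hessian u x + D = A"
    unfolding u_def hessian_quadratic[OF S] by (simp add: S_def)
  ultimately show ?thesis
    using pullback_du_section[OF U x_U smooth, of \<alpha> v X]
    by (simp add: section_x p_eq flip: D_def)
qed

lemma monge_ampere_form_unique: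
  assumes M: "open M" "open M'" and \<alpha>: "monge_ampere_form M M' \<rho> \<rho>' \<alpha>"
  shows "\<alpha> = restrict (canonical_form \<rho> \<rho>') (M \<times> M')"
\<comment> \<open>Forms are extensional, so agreement at the points of the product set
  suffices.\<close>
proof (rule PiE_ext)
  show "\<alpha> \<in> M \<times> M' \<rightarrow>\<^sub>E {a. alternating 3 a}"
    using \<alpha> by (simp add: monge_ampere_form_def forms_on_def)
  then have alt: "alternating 3 (\<alpha> p)" if "p \<in> M \<times> M'" for p
    using that by auto
  show "restrict (canonical_form \<rho> \<rho>') (M \<times> M') \<in> M \<times> M' \<rightarrow>\<^sub>E {a. alternating 3 a}"
    by (auto simp: alternating_canonical_form)
  fix p assume p: "p \<in> M \<times> M'"
  have "\<alpha> p v - canonical_form \<rho> \<rho>' p v = 0" for v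
  proof (rule effective_zero_on_graphs_imp_zero)
    show "alternating 3 (\<lambda>v. \<alpha> p v - canonical_form \<rho> \<rho>' p v)"
      by (intro alternating_diff alt p alternating_canonical_form)
    show "wedge 2 3 (omega cost p) (\<lambda>v. \<alpha> p v - canonical_form \<rho> \<rho>' p v) v = 0" for v
    proof -
      have "effective_on (M \<times> M') (omega cost) \<alpha>"
        using \<alpha> by (simp only: monge_ampere_form_def)
      then have "wedge 2 3 (omega cost p) (\<alpha> p) v = 0"
        using p unfolding effective_on_def by blast
      then show ?thesis
        by (simp add: wedge_diff_right canonical_form_effective)
    qed
    show "\<alpha> p (\<lambda>i. (v i, A *v v i)) - canonical_form \<rho> \<rho>' p (\<lambda>i. (v i, A *v v i)) = 0"
      if "transpose A = A" for A and v :: "nat \<Rightarrow> R3"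
      \<comment> \<open>For symmetric A, multiplication from the left and from the right agree,
        which matches the two descriptions of the graph.\<close>
      using monge_ampere_form_on_graphs[OF M \<alpha> p that, of v] transpose_matrix_vector[of A]
      by (simp add: that canonical_form_graph del: transpose_matrix_vector)
  qed
  then show "\<alpha> p = restrict (canonical_form \<rho> \<rho>') (M \<times> M') p"
    using p by (simp add: fun_eq_iff)
qed

theorem proposition3p1:
  fixes M M' :: "(real ^ 3) set" and \<rho> \<rho>' :: "real ^ 3 \<Rightarrow> real"
  assumes "open M" "M \<noteq> {}" "open M'" "M' \<noteq> {}"
    and "prob_density_on M \<rho>" "prob_density_on M' \<rho>'"
  shows "(\<forall>p\<in>M \<times> M'. omega cost p =
            (\<lambda>v. wedge 1 1 (differential (\<lambda>q. fst q $ 1) p) (differential (\<lambda>q. snd q $ 1) p) v +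
                 wedge 1 1 (differential (\<lambda>q. fst q $ 2) p) (differential (\<lambda>q. snd q $ 2) p) v +
                 wedge 1 1 (differential (\<lambda>q. fst q $ 3) p) (differential (\<lambda>q. snd q $ 3) p) v)) \<and>
         (\<exists>!\<alpha>. monge_ampere_form M M' \<rho> \<rho>' \<alpha>) \<and>
         (\<forall>\<alpha>. monge_ampere_form M M' \<rho> \<rho>' \<alpha> \<longrightarrow>
            (\<forall>p\<in>M \<times> M'. \<forall>V W. lychagin_rubtsov (omega cost) \<alpha> p V W =
               (\<rho> (fst p) * \<rho>' (snd p)) powr (2 / 3) * kim_mccann_warren cost \<rho> \<rho>' p V W))"
proof (intro conjI ballI allI impI)
  show "omega cost p =
      (\<lambda>v. wedge 1 1 (differential (\<lambda>q. fst q $ 1) p) (differential (\<lambda>q. snd q $ 1) p) v +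
           wedge 1 1 (differential (\<lambda>q. fst q $ 2) p) (differential (\<lambda>q. snd q $ 2) p) v +
           wedge 1 1 (differential (\<lambda>q. fst q $ 3) p) (differential (\<lambda>q. snd q $ 3) p) v)" for p
    by (rule omega_cost_canonical)
  show "\<exists>!\<alpha>. monge_ampere_form M M' \<rho> \<rho>' \<alpha>"
    using monge_ampere_form_canonical monge_ampere_form_unique[OF assms(1,3)] by blast
next
  fix \<alpha> p V W assume \<alpha>: "monge_ampere_form M M' \<rho> \<rho>' \<alpha>" and p: "p \<in> M \<times> M'"
  define r where "r = \<rho> (fst p) * \<rho>' (snd p)"
  have "\<alpha> p = canonical_form \<rho> \<rho>' p"
    using monge_ampere_form_unique[OF assms(1,3) \<alpha>] p by simp
  \<comment> \<open>The exponents add up to 1, and \<open>r powr 1 = r\<close> rests on r being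
    nonnegative; points where a density vanishes are included.\<close>
  moreover have "r powr (2 / 3) * r powr (1 / 3) = r"
  proof -
    have "0 \<le> r"
      using assms(5,6) p by (auto simp: r_def prob_density_on_def)
    then show ?thesis
      by (simp flip: powr_add)
  qed
  ultimately show "lychagin_rubtsov (omega cost) \<alpha> p V W =
      (\<rho> (fst p) * \<rho>' (snd p)) powr (2 / 3) * kim_mccann_warren cost \<rho> \<rho>' p V W"
    by (simp add: lychagin_rubtsov_canonical_form kim_mccann_warren_cost flip: r_def mult.assoc)
qed

end
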